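(* Let $0<m<n$ be relatively prime integers and let $T_{m,n}$ be the associated minimal Legendrian $2$-torus in $S^5$ (defined in the context). Let $A(\tfrac mn)$ denote the integral of the conformal factor $y$ of $T_{m,n}$ over one basic period of $y$ (defined in the context). Then $$\operatorname{Area}(T_{m,n})=\begin{cases}4n\pi\,A\!\left(\tfrac mn\right) & \text{if } mn \text{ is even},\\ 2n\pi\,A\!\left(\tfrac mn\right) & \text{if } mn \text{ is odd}.\end{cases}$$ Hence, if $mn$ is even then $$2n<\tfrac1{4\pi}\operatorname{Area}(T_{m,n})<\tfrac{2\pi}{\sqrt3}\,n,$$ and otherwise $$n<\tfrac1{4\pi}\operatorname{Area}(T_{m,n})<\tfrac{\pi}{\sqrt3}\,n .$$
   Context: Let $\operatorname{sn},\operatorname{cn},\operatorname{dn}$ be the Jacobi elliptic functions with modulus $k$ and $K(k)=\int_0^{\pi/2}(1-k^2\sin^2x)^{-1/2}dx$. For relatively prime integers $0<m<n$ put $$r^2=\frac{n+2m}{n},\qquad k^2=\frac{n^2-m^2}{n(n+2m)},\qquad c_1=\sqrt{\tfrac{n+m}{2n+m}},\quad c_2=\sqrt{\tfrac{n+m}{n+2m}},\quad c_3=\sqrt{\tfrac{n}{2n+m}},$$ with $r,k>0$, and $$u(s,t)=\Big(c_1e^{is}\operatorname{cn}(rt,k),\ i\,c_2e^{i\frac mn s}\operatorname{sn}(rt,k),\ c_3e^{-i(1+\frac mn)s}\operatorname{dn}(rt,k)\Big).$$ Then $u:\mathbb{R}^2\to S^5\subset\mathbb{C}^3$ is a conformal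 minimal Legendrian immersion, with induced metric $y(t)(ds^2+dt^2)$ for a function $y$ of $t$ of basic period $2K(k)/r$. Its period lattice $\Lambda$ has basis $(2n\pi,0),\,(0,4K(k)/r)$ if $mn$ is even, and $(2n\pi,0),\,(n\pi,2K(k)/r)$ if $mn$ is odd. $T_{m,n}$ is the embedded minimal Legendrian torus given by $\mathbb{R}^2/\Lambda$, with the metric induced from $S^5$. Finally $$A\!\left(\tfrac mn\right)=\int_0^{2K(k)/r}y(t)\,dt .$$ *)

theory Defs
  imports "HOL-Analysis.Analysis"
begin

text \<open>All functions take the modulus \<open>k\<close> (not the parameter \<open>k\<^sup>2\<close>) as first argument and are
  meant for real \<open>k\<close> with \<open>\<bar>k\<bar> < 1\<close>.  The interval integral is oriented, so that
  \<open>elliptic_F k\<close> is an odd, strictly increasing bijection of the reals for such \<open>k\<close>.\<close>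

definition elliptic_F :: "real \<Rightarrow> real \<Rightarrow> real" where
  "elliptic_F k \<phi> = (LBINT x=ereal 0..ereal \<phi>. 1 / sqrt (1 - k\<^sup>2 * (sin x)\<^sup>2))"

definition elliptic_K :: "real \<Rightarrow> real" where
  "elliptic_K k = elliptic_F k (pi / 2)"

definition jacobi_am :: "real \<Rightarrow> real \<Rightarrow> real" where
  "jacobi_am k t = (THE \<phi>. elliptic_F k \<phi> = t)"

definition jacobi_sn :: "real \<Rightarrow> real \<Rightarrow> real" where
  "jacobi_sn k t = sin (jacobi_am k t)"

definition jacobi_cn :: "real \<Rightarrow> real \<Rightarrow> real" where
  "jacobi_cn k t = cos (jacobi_am k t)"

definition jacobi_dn :: "real \<Rightarrow> real \<Rightarrow> real" where
  "jacobi_dn k t = sqrt (1 - k\<^sup>2 * (jacobi_sn k t)\<^sup>2)"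

text \<open>The first fundamental form of a parametrized surface in a Euclidean space.  On
  \<open>complex \<times> complex \<times> complex\<close> the inner product is the real part of the Hermitian one, i.e. the
  Euclidean metric of six-dimensional real space, which restricts to the round metric of the
  unit sphere.\<close>

definition induced_metric ::
    "(real \<times> real \<Rightarrow> 'a::real_inner) \<Rightarrow> real \<times> real \<Rightarrow> real \<times> real \<Rightarrow> real \<times> real \<Rightarrow> real" where
  "induced_metric u x v w = frechet_derivative u (at x) v \<bullet> frechet_derivative u (at x) w"

definition area_density :: "(real \<times> real \<Rightarrow> 'a::real_inner) \<Rightarrow> real \<times> real \<Rightarrow> real" where
  "area_density u x =
     sqrt (induced_metric u x (1, 0) (1, 0) * induced_metric u x (0, 1) (0, 1)
           - (induced_metric u x (1, 0) (0, 1))\<^sup>2)"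

definition conformal_factor :: "(real \<times> real \<Rightarrow> 'a::real_inner) \<Rightarrow> real \<Rightarrow> real" where
  "conformal_factor u = (THE y. \<forall>s t v w. induced_metric u (s, t) v w = y t * (v \<bullet> w))"

definition period_lattice :: "(real \<times> real \<Rightarrow> 'a) \<Rightarrow> (real \<times> real) set" where
  "period_lattice u = {p. \<forall>x. u (x + p) = u x}"

definition fundamental_domain :: "(real \<times> real) set \<Rightarrow> (real \<times> real) set \<Rightarrow> bool" where
  "fundamental_domain \<Lambda> D \<longleftrightarrow> D \<in> sets borel \<and> (\<forall>x. \<exists>!p. p \<in> \<Lambda> \<and> x - p \<in> D)"

text \<open>The area of the quotient of the plane by the period lattice of \<open>u\<close>, in the metric induced
  by \<open>u\<close>.  As the area density is invariant under the lattice, the integral does not depend on the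
  chosen Borel fundamental domain.\<close>

definition quotient_area :: "(real \<times> real \<Rightarrow> 'a::real_inner) \<Rightarrow> real" where
  "quotient_area u =
     (LINT x:(SOME D. fundamental_domain (period_lattice u) D)|lborel. area_density u x)"

definition torus_r :: "nat \<Rightarrow> nat \<Rightarrow> real" where
  "torus_r m n = sqrt ((real n + 2 * real m) / real n)"

definition torus_k :: "nat \<Rightarrow> nat \<Rightarrow> real" where
  "torus_k m n = sqrt (((real n)\<^sup>2 - (real m)\<^sup>2) / (real n * (real n + 2 * real m)))"

definition torus_c1 :: "nat \<Rightarrow> nat \<Rightarrow> real" where
  "torus_c1 m n = sqrt ((real n + real m) / (2 * real n + real m))"

definition torus_c2 :: "nat \<Rightarrow> nat \<Rightarrow> real" where
  "torus_c2 m n = sqrt ((real n + real m) / (real n + 2 * real m))"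

definition torus_c3 :: "nat \<Rightarrow> nat \<Rightarrow> real" where
  "torus_c3 m n = sqrt (real n / (2 * real n + real m))"

definition torus_map :: "nat \<Rightarrow> nat \<Rightarrow> real \<times> real \<Rightarrow> complex \<times> complex \<times> complex" where
  "torus_map m n = (\<lambda>(s, t).
     (of_real (torus_c1 m n) * cis s
        * of_real (jacobi_cn (torus_k m n) (torus_r m n * t)),
      \<i> * of_real (torus_c2 m n) * cis (real m / real n * s)
        * of_real (jacobi_sn (torus_k m n) (torus_r m n * t)),
      of_real (torus_c3 m n) * cis (- (1 + real m / real n) * s)
        * of_real (jacobi_dn (torus_k m n) (torus_r m n * t))))"

definition torus_area :: "nat \<Rightarrow> nat \<Rightarrow> real" where
  "torus_area m n = quotient_area (torus_map m n)"

text \<open>The following depends on \<open>m\<close> and \<open>n\<close> only through \<open>m / n\<close>, because \<open>torus_map\<close>,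
  \<open>torus_k\<close> and \<open>torus_r\<close> do.\<close>

definition torus_A :: "nat \<Rightarrow> nat \<Rightarrow> real" where
  "torus_A m n =
     (LBINT t=ereal 0..ereal (2 * elliptic_K (torus_k m n) / torus_r m n).
        conformal_factor (torus_map m n) t)"

end

theory Submission
  imports Defs
begin

text \<open>Write \<open>\<alpha> = m / n\<close>, \<open>S = sn\<^sup>2\<close>, \<open>C = cn\<^sup>2\<close> at \<open>r t\<close>.  A direct computation gives the conformal
  factor \<open>y = (1 + \<alpha>) (1 - (1 - \<alpha>) S)\<close>, so the area is the integral of \<open>y\<close> over any fundamental
  domain of the lattice of pairs \<open>(n l \<pi>, 2 j K / r)\<close> with \<open>n l \<equiv> j \<equiv> m l (mod 2)\<close>; a rectangle of
  width \<open>2 n \<pi>\<close> and height \<open>4 K / r\<close> or \<open>2 K / r\<close> will do.  The bounds \<open>2 < A < 2 \<pi> / \<surd>3\<close> are obtained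
  without substituting in the integral, by comparing \<open>y\<close> pointwise with derivatives of explicit
  functions:  \<open>y > \<bar>(sn (r t))'\<bar>\<close>, where \<open>sn\<close> rises from 0 to 1 and falls back to 0 over a period of \<open>y\<close>,
  and \<open>y < 2 / \<surd>3 (am (r t))'\<close>, where \<open>am\<close> increases by \<open>\<pi>\<close>.\<close>

section \<open>Jacobi elliptic functions\<close>

lemma elliptic_radicand_pos:
  fixes k :: real
  assumes "k\<^sup>2 < 1"
  shows "0 < 1 - k\<^sup>2 * (sin x)\<^sup>2"
proof -
  have "k\<^sup>2 * (sin x)\<^sup>2 \<le> k\<^sup>2 * 1"
    by (intro mult_left_mono) (auto simp: abs_square_le_1)
  with assms show ?thesis by simp
qed

lemma isCont_elliptic_integrand:
  fixes k :: real
  assumes "k\<^sup>2 < 1"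
  shows "isCont (\<lambda>x. 1 / sqrt (1 - k\<^sup>2 * (sin x)\<^sup>2)) x"
  using elliptic_radicand_pos[OF assms, of x] by (intro continuous_intros) auto

lemma has_real_derivative_interval_integral:
  fixes g :: "real \<Rightarrow> real"
  assumes "continuous_on UNIV g"
  shows "((\<lambda>x. LBINT t=ereal 0..ereal x. g t) has_real_derivative g x) (at x)"
proof -
  \<comment> \<open>The interval must contain the base point 0 and have \<open>x\<close> in its
    interior, so that the derivative within it is a two-sided one.\<close>
  define a b where "a = min 0 (x - 1)" and "b = max 0 (x + 1)"
  have ab: "a \<le> 0" "0 \<le> b" "a < x" "x < b" by (auto simp: a_def b_def)
  have "continuous_on {a..b} g"
    using assms continuous_on_subset by blast
  then have "((\<lambda>x. LBINT t=ereal 0..ereal x. g t) has_vector_derivative g x) (at x within {a..b})"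
    using ab by (intro interval_integral_FTC2) auto
  then show ?thesis
    using ab at_within_Icc_at[of a x b]
    by (simp add: has_real_derivative_iff_has_vector_derivative)
qed

lemma has_real_derivative_elliptic_F:
  assumes "k\<^sup>2 < 1"
  shows "(elliptic_F k has_real_derivative 1 / sqrt (1 - k\<^sup>2 * (sin x)\<^sup>2)) (at x)"
  unfolding elliptic_F_def[abs_def]
  using isCont_elliptic_integrand[OF assms]
  by (intro has_real_derivative_interval_integral) (simp add: continuous_at_imp_continuous_on)

lemma elliptic_F_0 [simp]: "elliptic_F k 0 = 0"
  by (simp add: elliptic_F_def interval_integral_endpoints_same)

text \<open>The integrand is at least 1. Strict monotonicity, surjectivity and positivity of
  \<open>elliptic_K\<close> all follow from this growth bound.\<close>

lemma elliptic_F_diff_ge: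
  assumes "k\<^sup>2 < 1" "x \<le> y"
  shows "y - x \<le> elliptic_F k y - elliptic_F k x"
proof -
  have "elliptic_F k x - x \<le> elliptic_F k y - y"
  proof (rule DERIV_nonneg_imp_nondecreasing[OF assms(2)])
    fix z :: real
    have "sqrt (1 - k\<^sup>2 * (sin z)\<^sup>2) \<le> 1" by simp
    then have "0 \<le> 1 / sqrt (1 - k\<^sup>2 * (sin z)\<^sup>2) - 1"
      using elliptic_radicand_pos[OF assms(1), of z] by (simp add: field_simps)
    moreover have "((\<lambda>x. elliptic_F k x - x) has_real_derivative
        1 / sqrt (1 - k\<^sup>2 * (sin z)\<^sup>2) - 1) (at z)"
      by (intro derivative_intros has_real_derivative_elliptic_F assms(1))
    ultimately show "\<exists>d. ((\<lambda>x. elliptic_F k x - x) has_real_derivative d) (at z) \<and> 0 \<le> d"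
      by blast
  qed
  then show ?thesis by simp
qed

lemma strict_mono_elliptic_F: "k\<^sup>2 < 1 \<Longrightarrow> strict_mono (elliptic_F k)"
  using elliptic_F_diff_ge[of k] by (intro strict_monoI) (smt (verit))

lemma continuous_elliptic_F: "k\<^sup>2 < 1 \<Longrightarrow> isCont (elliptic_F k) x"
  using has_real_derivative_elliptic_F DERIV_isCont by blast

lemma bij_elliptic_F:
  assumes "k\<^sup>2 < 1"
  shows "bij (elliptic_F k)"
proof (rule bijI)
  show "inj (elliptic_F k)"
    using strict_mono_elliptic_F[OF assms] by (rule strict_mono_imp_inj_on)
  show "surj (elliptic_F k)"
  proof (rule surjI)
    fix t
    \<comment> \<open>The growth bound from \<open>elliptic_F k 0 = 0\<close> puts \<open>t\<close>
      between the values at \<open>- \<bar>t\<bar>\<close> and \<open>\<bar>t\<bar>\<close>, and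
      continuity supplies a preimage.\<close>
    have "elliptic_F k (- \<bar>t\<bar>) \<le> t" "t \<le> elliptic_F k \<bar>t\<bar>"
      using elliptic_F_diff_ge[OF assms, of 0 "\<bar>t\<bar>"] elliptic_F_diff_ge[OF assms, of "- \<bar>t\<bar>" 0] by auto
    then obtain x where "elliptic_F k x = t"
      using IVT[of "elliptic_F k" "- \<bar>t\<bar>" t "\<bar>t\<bar>"] continuous_elliptic_F[OF assms] by auto
    then show "elliptic_F k (SOME x. elliptic_F k x = t) = t" by (rule someI)
  qed
qed

section \<open>The amplitude and the derivatives of sn, cn and dn\<close>

lemma jacobi_am_eq_iff:
  assumes "k\<^sup>2 < 1"
  shows "jacobi_am k t = x \<longleftrightarrow> elliptic_F k x = t"
proof -
  \<comment> \<open>Bijectivity gives the \<open>THE\<close> in \<open>jacobi_am\<close> its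
    meaning; the amplitude is then handled only as the inverse of \<open>elliptic_F\<close>.\<close>
  have "\<exists>!x. elliptic_F k x = t" using bij_elliptic_F[OF assms] by (metis bij_pointE)
  from theI'[OF this] this show ?thesis unfolding jacobi_am_def by blast
qed

lemma elliptic_F_jacobi_am: "k\<^sup>2 < 1 \<Longrightarrow> elliptic_F k (jacobi_am k t) = t"
  using jacobi_am_eq_iff by blast

lemma jacobi_am_elliptic_F: "k\<^sup>2 < 1 \<Longrightarrow> jacobi_am k (elliptic_F k x) = x"
  using jacobi_am_eq_iff by blast

lemma jacobi_am_0: "k\<^sup>2 < 1 \<Longrightarrow> jacobi_am k 0 = 0"
  using jacobi_am_eq_iff by simp

lemma isCont_jacobi_am:
  assumes "k\<^sup>2 < 1"
  shows "isCont (jacobi_am k) t"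
  using isCont_inverse_function[of 1 "jacobi_am k t" "jacobi_am k" "elliptic_F k"] assms
  by (simp add: jacobi_am_elliptic_F elliptic_F_jacobi_am continuous_elliptic_F)

lemma jacobi_dn_pos: "k\<^sup>2 < 1 \<Longrightarrow> 0 < jacobi_dn k t"
  unfolding jacobi_dn_def jacobi_sn_def using elliptic_radicand_pos by simp

lemma jacobi_sn_cn: "(jacobi_sn k t)\<^sup>2 + (jacobi_cn k t)\<^sup>2 = 1"
  by (simp add: jacobi_sn_def jacobi_cn_def)

lemma jacobi_dn_squared: "k\<^sup>2 < 1 \<Longrightarrow> (jacobi_dn k t)\<^sup>2 = 1 - k\<^sup>2 * (jacobi_sn k t)\<^sup>2"
  unfolding jacobi_dn_def jacobi_sn_def using elliptic_radicand_pos by (simp add: less_imp_le)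

text \<open>Inverse function rule: \<open>elliptic_F k\<close> has slope
  \<open>1 / jacobi_dn k t\<close> at the amplitude.\<close>

lemma has_real_derivative_jacobi_am:
  assumes "k\<^sup>2 < 1"
  shows "(jacobi_am k has_real_derivative jacobi_dn k t) (at t)"
proof -
  have "(jacobi_am k has_real_derivative inverse (1 / jacobi_dn k t)) (at t)"
  proof (rule DERIV_inverse_function[where a = "t - 1" and b = "t + 1" and f = "elliptic_F k"])
    show "(elliptic_F k has_real_derivative 1 / jacobi_dn k t) (at (jacobi_am k t))"
      using has_real_derivative_elliptic_F[OF assms, of "jacobi_am k t"]
      by (simp add: jacobi_dn_def jacobi_sn_def)
  qed (use jacobi_dn_pos[OF assms, of t] in
      \<open>auto simp: elliptic_F_jacobi_am[OF assms] isCont_jacobi_am[OF assms]\<close>)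
  then show ?thesis by simp
qed

lemma has_real_derivative_jacobi_sn:
  assumes "k\<^sup>2 < 1"
  shows "(jacobi_sn k has_real_derivative jacobi_cn k t * jacobi_dn k t) (at t)"
  unfolding jacobi_sn_def[abs_def] jacobi_cn_def
  by (rule derivative_eq_intros has_real_derivative_jacobi_am[OF assms] refl)+

lemma has_real_derivative_jacobi_cn:
  assumes "k\<^sup>2 < 1"
  shows "(jacobi_cn k has_real_derivative - jacobi_sn k t * jacobi_dn k t) (at t)"
  unfolding jacobi_cn_def[abs_def] jacobi_sn_def
  by (rule derivative_eq_intros has_real_derivative_jacobi_am[OF assms] refl)+

lemma has_real_derivative_jacobi_dn:
  assumes "k\<^sup>2 < 1"
  shows "(jacobi_dn k has_real_derivative - k\<^sup>2 * jacobi_sn k t * jacobi_cn k t) (at t)"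
proof -
  have "0 < jacobi_dn k t" by (rule jacobi_dn_pos[OF assms])
  \<comment> \<open>Differentiating the square root in dn requires a positive radicand.\<close>
  then have "0 < 1 - k\<^sup>2 * (jacobi_sn k t)\<^sup>2" by (simp add: jacobi_dn_def)
  then have "(jacobi_dn k has_real_derivative
      (- (k\<^sup>2 * (2 * jacobi_sn k t * (jacobi_cn k t * jacobi_dn k t)))) / (2 * jacobi_dn k t)) (at t)"
    unfolding jacobi_dn_def[abs_def]
    by (auto intro!: derivative_eq_intros has_real_derivative_jacobi_sn[OF assms, unfolded jacobi_dn_def]
        simp: field_simps power2_eq_square)
  then show ?thesis using \<open>0 < jacobi_dn k t\<close> by (simp add: field_simps)
qed

section \<open>Symmetry, half periods and zeros\<close>

lemma elliptic_F_minus: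
  assumes "k\<^sup>2 < 1"
  shows "elliptic_F k (- x) = - elliptic_F k x"
proof -
  have "((\<lambda>x. elliptic_F k (- x) + elliptic_F k x) has_real_derivative 0) (at z)" for z
    by (auto intro!: derivative_eq_intros DERIV_chain2[OF has_real_derivative_elliptic_F[OF assms]]
        has_real_derivative_elliptic_F[OF assms])
  then have "elliptic_F k (- x) + elliptic_F k x = elliptic_F k (- 0) + elliptic_F k 0"
    by (intro DERIV_const_ratio_const DERIV_isconst_all) auto
  then show ?thesis by simp
qed

text \<open>The integrand has period \<open>pi\<close>, so the increment is constant; evaluated at
  \<open>- pi / 2\<close>, oddness makes it \<open>2 * elliptic_K k\<close>.\<close>

lemma elliptic_F_plus_pi:
  assumes "k\<^sup>2 < 1"
  shows "elliptic_F k (x + pi) = elliptic_F k x + 2 * elliptic_K k"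
proof -
  have "((\<lambda>x. elliptic_F k (x + pi) - elliptic_F k x) has_real_derivative 0) (at z)" for z
    by (auto intro!: derivative_eq_intros DERIV_chain2[OF has_real_derivative_elliptic_F[OF assms]]
        has_real_derivative_elliptic_F[OF assms])
  then have "elliptic_F k (x + pi) - elliptic_F k x
      = elliptic_F k (- (pi / 2) + pi) - elliptic_F k (- (pi / 2))"
    by (intro DERIV_isconst_all) auto
  then show ?thesis by (simp only: elliptic_F_minus[OF assms]) (simp add: elliptic_K_def)
qed

lemma elliptic_F_plus_int_pi:
  assumes "k\<^sup>2 < 1"
  shows "elliptic_F k (x + of_int j * pi) = elliptic_F k x + 2 * of_int j * elliptic_K k"
proof (induction j rule: int_induct[where k = 0])
  case (step1 i)
  then show ?case
    using elliptic_F_plus_pi[OF assms, of "x + of_int i * pi"] by (simp add: algebra_simps)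
next
  case (step2 i)
  then show ?case
    using elliptic_F_plus_pi[OF assms, of "x + of_int (i - 1) * pi"] by (simp add: algebra_simps)
qed simp

lemma elliptic_K_pos: "k\<^sup>2 < 1 \<Longrightarrow> 0 < elliptic_K k"
  using elliptic_F_diff_ge[of k 0 "pi / 2"] pi_gt_zero unfolding elliptic_K_def elliptic_F_0 by linarith

text \<open>A shift of the amplitude by \<open>j * pi\<close> multiplies sn and cn by the sign of
  \<open>j\<close> and leaves dn, which depends on the square of sn, unchanged. These signs are the
  origin of the parity conditions on the period lattice.\<close>

lemma jacobi_am_plus_int_K:
  assumes "k\<^sup>2 < 1"
  shows "jacobi_am k (t + 2 * of_int j * elliptic_K k) = jacobi_am k t + of_int j * pi"
  unfolding jacobi_am_eq_iff[OF assms]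
  by (simp add: elliptic_F_plus_int_pi[OF assms] elliptic_F_jacobi_am[OF assms])

lemma jacobi_sn_plus_int_K:
  assumes "k\<^sup>2 < 1"
  shows "jacobi_sn k (t + 2 * of_int j * elliptic_K k) = (if even j then 1 else - 1) * jacobi_sn k t"
  by (simp add: jacobi_sn_def jacobi_am_plus_int_K[OF assms] sin_add mult.commute[of _ pi])

lemma jacobi_cn_plus_int_K:
  assumes "k\<^sup>2 < 1"
  shows "jacobi_cn k (t + 2 * of_int j * elliptic_K k) = (if even j then 1 else - 1) * jacobi_cn k t"
  by (simp add: jacobi_cn_def jacobi_am_plus_int_K[OF assms] cos_add mult.commute[of _ pi])

lemma jacobi_dn_plus_int_K:
  assumes "k\<^sup>2 < 1"
  shows "jacobi_dn k (t + 2 * of_int j * elliptic_K k) = jacobi_dn k t"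
  by (simp add: jacobi_dn_def jacobi_sn_plus_int_K[OF assms])

text \<open>Used to find the possible second components of a period: the zeros of the sine in the
  amplitude are carried over by \<open>elliptic_F\<close>.\<close>

lemma jacobi_sn_eq_0_iff:
  assumes "k\<^sup>2 < 1"
  shows "jacobi_sn k t = 0 \<longleftrightarrow> (\<exists>j::int. t = 2 * of_int j * elliptic_K k)"
proof -
  have "jacobi_sn k t = 0 \<longleftrightarrow> (\<exists>j::int. jacobi_am k t = of_int j * pi)"
    by (simp add: jacobi_sn_def sin_zero_iff_int2)
  also have "\<dots> \<longleftrightarrow> (\<exists>j::int. elliptic_F k (of_int j * pi) = t)"
    by (simp add: jacobi_am_eq_iff[OF assms])
  also have "\<dots> \<longleftrightarrow> (\<exists>j::int. t = 2 * of_int j * elliptic_K k)"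
    using elliptic_F_plus_int_pi[OF assms, of 0] by auto
  finally show ?thesis .
qed

section \<open>Fundamental domains\<close>

lemma nn_integral_lborel_shift:
  fixes f :: "'a::euclidean_space \<Rightarrow> ennreal"
  assumes [measurable]: "f \<in> borel_measurable borel"
  shows "(\<integral>\<^sup>+x. f (c + x) \<partial>lborel) = (\<integral>\<^sup>+x. f x \<partial>lborel)"
proof -
  have "(\<integral>\<^sup>+x. f x \<partial>lborel) = (\<integral>\<^sup>+x. f x \<partial>distr lborel borel ((+) c))"
    by (simp only: lborel_distr_plus)
  also have "\<dots> = (\<integral>\<^sup>+x. f (c + x) \<partial>lborel)" by (intro nn_integral_distr) auto
  finally show ?thesis by simp
qed

text \<open>A condition met exactly once sums to the factor 1. This inserts a sum over the lattice
  into an integral and removes it again.\<close>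

lemma nn_integral_count_space_indicator_unique:
  assumes "\<exists>!p. p \<in> \<Lambda> \<and> P p"
  shows "(\<integral>\<^sup>+p. c * indicator {p. P p} p \<partial>count_space \<Lambda>) = c"
proof -
  have "\<exists>!p. p \<in> {p\<in>\<Lambda>. P p}" using assms by simp
  then obtain q where q: "{p\<in>\<Lambda>. P p} = {q}" by blast
  have "(\<integral>\<^sup>+p. c * indicator {p. P p} p \<partial>count_space \<Lambda>) = (\<integral>\<^sup>+p. c * indicator {q} p \<partial>count_space \<Lambda>)"
  proof (rule nn_integral_cong)
    fix p assume "p \<in> space (count_space \<Lambda>)"
    then have "P p \<longleftrightarrow> p = q" using q by auto
    then show "c * indicator {p. P p} p = c * indicator {q} p" by (simp add: indicator_def)
  qed
  also have "\<dots> = c * emeasure (count_space \<Lambda>) {q}" 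
    using q by (intro nn_integral_cmult_indicator) auto
  also have "\<dots> = c" using q by (subst emeasure_count_space_finite) auto
  finally show ?thesis .
qed

text \<open>Both sides equal the sum over \<open>p \<in> \<Lambda>\<close> of the integrals over \<open>D \<inter> (E + p)\<close>.\<close>

lemma nn_integral_fundamental_domain_cong:
  fixes f :: "real \<times> real \<Rightarrow> ennreal"
  assumes "countable \<Lambda>" and uminus: "\<And>p. p \<in> \<Lambda> \<Longrightarrow> - p \<in> \<Lambda>"
    and f [measurable]: "f \<in> borel_measurable borel"
    and periodic: "\<And>p x. p \<in> \<Lambda> \<Longrightarrow> f (x + p) = f x"
    and D: "fundamental_domain \<Lambda> D" and E: "fundamental_domain \<Lambda> E"
  shows "(\<integral>\<^sup>+x. f x * indicator D x \<partial>lborel) = (\<integral>\<^sup>+x. f x * indicator E x \<partial>lborel)"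
proof -
  have [measurable]: "D \<in> sets borel" "E \<in> sets borel"
    using D E by (auto simp: fundamental_domain_def)
  have unique_E: "\<exists>!p. p \<in> \<Lambda> \<and> x - p \<in> E" for x
    using E unfolding fundamental_domain_def by blast
  \<comment> \<open>After the translation by \<open>p\<close> the domain \<open>D\<close> is met by
    \<open>x + p\<close> instead of \<open>x - p\<close>; symmetry of the lattice under negation
    links the two.\<close>
  have unique_D: "\<exists>!p. p \<in> \<Lambda> \<and> x + p \<in> D" for x
  proof -
    have "\<exists>!p. p \<in> \<Lambda> \<and> x - p \<in> D" using D unfolding fundamental_domain_def by blast
    then obtain q where q: "q \<in> \<Lambda>" "x - q \<in> D" "\<And>p. p \<in> \<Lambda> \<Longrightarrow> x - p \<in> D \<Longrightarrow> p = q" by blast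
    have "- q \<in> \<Lambda> \<and> x + - q \<in> D" using q(1,2) uminus by simp
    moreover have "p = - q" if "p \<in> \<Lambda> \<and> x + p \<in> D" for p
    proof -
      have "- p = q" using that uminus by (intro q(3)) auto
      then have "- (- p) = - q" by (rule arg_cong)
      then show ?thesis by (simp only: minus_minus)
    qed
    ultimately show ?thesis by blast
  qed
  have "(\<integral>\<^sup>+x. f x * indicator D x \<partial>lborel)
      = (\<integral>\<^sup>+x. \<integral>\<^sup>+p. f x * indicator D x * indicator {p. x - p \<in> E} p \<partial>count_space \<Lambda> \<partial>lborel)"
    by (simp only: nn_integral_count_space_indicator_unique[OF unique_E])
  also have "\<dots> = (\<integral>\<^sup>+x. \<integral>\<^sup>+p. f x * indicator D x * indicator E (x - p) \<partial>count_space \<Lambda> \<partial>lborel)"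
    by (simp add: indicator_def)
  also have "\<dots> = (\<integral>\<^sup>+p. \<integral>\<^sup>+x. f x * indicator D x * indicator E (x - p) \<partial>lborel \<partial>count_space \<Lambda>)"
    using \<open>countable \<Lambda>\<close> by (intro nn_integral_count_space_nn_integral) auto
  also have "\<dots> = (\<integral>\<^sup>+p. \<integral>\<^sup>+x. f x * indicator E x * indicator D (x + p) \<partial>lborel \<partial>count_space \<Lambda>)"
  proof (rule nn_integral_cong)
    fix p assume "p \<in> space (count_space \<Lambda>)"
    then have p: "p \<in> \<Lambda>" by simp
    have "(\<integral>\<^sup>+x. f x * indicator D x * indicator E (x - p) \<partial>lborel)
        = (\<integral>\<^sup>+x. f (p + x) * indicator D (p + x) * indicator E (p + x - p) \<partial>lborel)"
      by (intro nn_integral_lborel_shift[symmetric]) measurable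
    also have "\<dots> = (\<integral>\<^sup>+x. f x * indicator E x * indicator D (x + p) \<partial>lborel)"
      using periodic[OF p] by (intro nn_integral_cong) (simp add: add.commute mult_ac)
    finally show "(\<integral>\<^sup>+x. f x * indicator D x * indicator E (x - p) \<partial>lborel)
        = (\<integral>\<^sup>+x. f x * indicator E x * indicator D (x + p) \<partial>lborel)" .
  qed
  also have "\<dots> = (\<integral>\<^sup>+x. \<integral>\<^sup>+p. f x * indicator E x * indicator D (x + p) \<partial>count_space \<Lambda> \<partial>lborel)"
    using \<open>countable \<Lambda>\<close> by (intro nn_integral_count_space_nn_integral[symmetric]) auto
  also have "\<dots> = (\<integral>\<^sup>+x. \<integral>\<^sup>+p. f x * indicator E x * indicator {p. x + p \<in> D} p \<partial>count_space \<Lambda> \<partial>lborel)"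
    by (simp add: indicator_def)
  also have "\<dots> = (\<integral>\<^sup>+x. f x * indicator E x \<partial>lborel)"
    by (simp only: nn_integral_count_space_indicator_unique[OF unique_D])
  finally show ?thesis .
qed

text \<open>For nonnegative \<open>f\<close> this needs no integrability: a non-integrable
  \<open>f\<close> gives the default value 0 on both sides.\<close>

lemma set_lebesgue_integral_eq_enn2real:
  fixes f :: "'a::euclidean_space \<Rightarrow> real"
  assumes [measurable]: "f \<in> borel_measurable borel" "D \<in> sets borel" and "\<And>x. 0 \<le> f x"
  shows "(LINT x:D|lborel. f x) = enn2real (\<integral>\<^sup>+x. ennreal (f x) * indicator D x \<partial>lborel)"
proof -
  have "(LINT x:D|lborel. f x) = enn2real (\<integral>\<^sup>+x. ennreal (indicator D x *\<^sub>R f x) \<partial>lborel)"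
    unfolding set_lebesgue_integral_def
    using assms(3) by (intro integral_eq_nn_integral) (auto simp: indicator_def)
  also have "(\<integral>\<^sup>+x. ennreal (indicator D x *\<^sub>R f x) \<partial>lborel) = (\<integral>\<^sup>+x. ennreal (f x) * indicator D x \<partial>lborel)"
    by (intro nn_integral_cong) (auto simp: indicator_def)
  finally show ?thesis .
qed

lemma uminus_mem_period_lattice: "p \<in> period_lattice u \<Longrightarrow> - p \<in> period_lattice u"
proof -
  assume p: "p \<in> period_lattice u"
  have "u (x + - p) = u x" for x
  proof -
    from p have "u ((x - p) + p) = u (x - p)" unfolding period_lattice_def by blast
    then show ?thesis by simp
  qed
  then show ?thesis by (simp add: period_lattice_def)
qed

text \<open>Removes the \<open>SOME\<close> from the area: once one fundamental domain is exhibited,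
  the chosen set is one as well, and both give the same integral.\<close>

lemma quotient_area_eq:
  fixes u :: "real \<times> real \<Rightarrow> 'a::real_inner"
  assumes "countable (period_lattice u)" and f: "area_density u \<in> borel_measurable borel"
    and nonneg: "\<And>x. 0 \<le> area_density u x"
    and periodic: "\<And>p x. p \<in> period_lattice u \<Longrightarrow> area_density u (x + p) = area_density u x"
    and D: "fundamental_domain (period_lattice u) D"
  shows "quotient_area u = (LINT x:D|lborel. area_density u x)"
proof -
  define E where "E = (SOME D. fundamental_domain (period_lattice u) D)"
  have E: "fundamental_domain (period_lattice u) E" unfolding E_def using D by (rule someI)
  have [measurable]: "D \<in> sets borel" "E \<in> sets borel"
    using D E by (auto simp: fundamental_domain_def)
  have "(\<integral>\<^sup>+x. ennreal (area_density u x) * indicator E x \<partial>lborel)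
      = (\<integral>\<^sup>+x. ennreal (area_density u x) * indicator D x \<partial>lborel)"
    using assms(1) uminus_mem_period_lattice _ _ E D
    by (rule nn_integral_fundamental_domain_cong) (use f periodic in auto)
  then show ?thesis
    unfolding quotient_area_def E_def[symmetric]
    using f nonneg by (simp add: set_lebesgue_integral_eq_enn2real)
qed

section \<open>Rectangles as domains of integration and as fundamental domains\<close>

lemma set_lebesgue_integral_strip:
  fixes g :: "real \<Rightarrow> real"
  assumes "continuous_on UNIV g" and nonneg: "\<And>t. 0 \<le> g t" and "0 \<le> a" "0 \<le> b"
  shows "(LINT x:{0..<a} \<times> {0..<b}|lborel. g (snd x)) = a * (LBINT t=ereal 0..ereal b. g t)"
proof -
  have [measurable]: "g \<in> borel_measurable borel"
    using assms(1) by (rule borel_measurable_continuous_onI)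
  have "(\<integral>\<^sup>+x. ennreal (g (snd x)) * indicator ({0..<a} \<times> {0..<b}) x \<partial>(lborel :: (real \<times> real) measure))
      = (\<integral>\<^sup>+s. \<integral>\<^sup>+t. ennreal (g t) * indicator ({0..<a} \<times> {0..<b}) (s, t) \<partial>lborel \<partial>lborel)"
    by (subst lborel_prod[symmetric], subst lborel.nn_integral_fst[symmetric]) auto
  also have "\<dots> = (\<integral>\<^sup>+s. \<integral>\<^sup>+t. indicator {0..<a} s * (ennreal (g t) * indicator {0..<b} t) \<partial>lborel \<partial>lborel)"
    by (simp add: indicator_times mult_ac)
  also have "\<dots> = (\<integral>\<^sup>+s. indicator {0..<a} s * (\<integral>\<^sup>+t. ennreal (g t) * indicator {0..<b} t \<partial>lborel) \<partial>lborel)"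
    by (intro nn_integral_cong nn_integral_cmult) auto
  also have "\<dots> = ennreal a * (\<integral>\<^sup>+t. ennreal (g t) * indicator {0..<b} t \<partial>lborel)"
    using \<open>0 \<le> a\<close> by (subst nn_integral_multc) auto
  finally have eq: "(\<integral>\<^sup>+x. ennreal (g (snd x)) * indicator ({0..<a} \<times> {0..<b}) x \<partial>(lborel :: (real \<times> real) measure))
      = ennreal a * (\<integral>\<^sup>+t. ennreal (g t) * indicator {0..<b} t \<partial>lborel)" .
  have "(LINT x:{0..<a} \<times> {0..<b}|lborel. g (snd x)) = a * (LINT t:{0..<b}|lborel. g t)"
  proof (subst (1 2) set_lebesgue_integral_eq_enn2real)
    show "(\<lambda>x. g (snd x)) \<in> borel_measurable (borel :: (real \<times> real) measure)"
      by (simp flip: borel_prod)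
    show "{0..<a} \<times> {0..<b} \<in> sets (borel :: (real \<times> real) measure)" by (intro borel_Times) auto
  qed (use \<open>0 \<le> a\<close> nonneg eq in \<open>simp_all add: enn2real_mult\<close>)
  also have "\<dots> = a * (LBINT t=ereal 0..ereal b. g t)"
    using \<open>0 \<le> b\<close> by (simp add: interval_integral_Ico)
  finally show ?thesis .
qed

lemma ex1_int_shift_mem_Ico:
  fixes x w :: real
  assumes "0 < w"
  shows "\<exists>!j::int. x - of_int j * w \<in> {0..<w}"
proof -
  have "x - of_int j * w \<in> {0..<w} \<longleftrightarrow> \<lfloor>x / w\<rfloor> = j" for j :: int
    using assms by (auto simp: floor_eq_iff field_simps)
  then show ?thesis by simp
qed

text \<open>The lattice is spanned by \<open>(w, 0)\<close> and \<open>(c, h)\<close>. The second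
  coordinate determines \<open>j\<close>; the first, corrected by \<open>j * c\<close>, then
  determines \<open>i\<close>. The shear \<open>c\<close> lets a rectangle serve also for the
  oblique lattice of odd \<open>m * n\<close>.\<close>

lemma fundamental_domain_rectangle:
  fixes w h c :: real
  assumes "0 < w" "0 < h"
  shows "fundamental_domain {(of_int j * c + of_int i * w, of_int j * h) |i j :: int. True}
    ({0..<w} \<times> {0..<h})"
  unfolding fundamental_domain_def
proof (intro conjI allI)
  show "{0..<w} \<times> {0..<h} \<in> sets borel" by (intro borel_Times) auto
  fix x :: "real \<times> real"
  obtain j :: int where j: "snd x - of_int j * h \<in> {0..<h}"
      "\<And>j' :: int. snd x - of_int j' * h \<in> {0..<h} \<Longrightarrow> j' = j"
    using ex1_int_shift_mem_Ico[OF assms(2), of "snd x"] by blast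
  obtain i :: int where i: "fst x - of_int j * c - of_int i * w \<in> {0..<w}"
      "\<And>i' :: int. fst x - of_int j * c - of_int i' * w \<in> {0..<w} \<Longrightarrow> i' = i"
    using ex1_int_shift_mem_Ico[OF assms(1), of "fst x - of_int j * c"] by blast
  show "\<exists>!p. p \<in> {(of_int j * c + of_int i * w, of_int j * h) |i j :: int. True}
      \<and> x - p \<in> {0..<w} \<times> {0..<h}"
  proof (rule ex1I)
    show "(of_int j * c + of_int i * w, of_int j * h)
        \<in> {(of_int j * c + of_int i * w, of_int j * h) |i j :: int. True}
      \<and> x - (of_int j * c + of_int i * w, of_int j * h) \<in> {0..<w} \<times> {0..<h}"
      using i(1) j(1) by (cases x) (auto simp: algebra_simps)
  next
    fix p
    assume "p \<in> {(of_int j * c + of_int i * w, of_int j * h) |i j :: int. True}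
      \<and> x - p \<in> {0..<w} \<times> {0..<h}"
    then have x: "x - p \<in> {0..<w} \<times> {0..<h}"
      and "\<exists>i' j' :: int. p = (of_int j' * c + of_int i' * w, of_int j' * h)" by auto
    then obtain i' j' :: int where p: "p = (of_int j' * c + of_int i' * w, of_int j' * h)" by blast
    have "snd x - of_int j' * h \<in> {0..<h}" using x unfolding p by (cases x) auto
    then have [simp]: "j' = j" by (rule j(2))
    have "fst x - of_int j * c - of_int i' * w \<in> {0..<w}"
      using x unfolding p by (cases x) (auto simp: algebra_simps)
    then have "i' = i" by (rule i(2))
    then show "p = (of_int j * c + of_int i * w, of_int j * h)" by (simp add: p)
  qed
qed

section \<open>The tori\<close>

text \<open>Turns the requirement that a phase cancel the sign of sn or cn into a congruence modulo
  2.\<close>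

lemma cis_eq_sign_iff:
  "cis x = (if even j then 1 else - 1) \<longleftrightarrow> (\<exists>i::int. x = of_int i * pi \<and> (even i \<longleftrightarrow> even (j::int)))"
proof
  assume "cis x = (if even j then 1 else - 1)"
  then have sc: "sin x = 0" "cos x = (if even j then 1 else - 1)"
    by (auto simp: complex_eq_iff split: if_splits)
  then obtain i :: int where "x = of_int i * pi" by (auto simp: sin_zero_iff_int2)
  with sc show "\<exists>i::int. x = of_int i * pi \<and> (even i \<longleftrightarrow> even j)"
    by (auto simp: mult.commute[of _ pi] split: if_splits)
qed (auto simp: complex_eq_iff mult.commute[of _ pi])

text \<open>Multiplication by \<open>z\<close> is a similarity of the plane, so the unit phases of
  the coordinates drop out of the metric.\<close>

lemma inner_mult_complex: "(z * v) \<bullet> (z * w) = (cmod z)\<^sup>2 * (v \<bullet> w)" for z v w :: complex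
  by (simp add: inner_complex_def cmod_power2) (simp add: power2_eq_square algebra_simps)

text \<open>All three coordinates have this shape. With the phase pulled out, the
  \<open>t\<close>-direction is real and the \<open>s\<close>-direction imaginary, so they are
  orthogonal in each coordinate up to the common factor \<open>a\<close>.\<close>

lemma has_derivative_cis_mult:
  assumes "(g has_real_derivative g') (at t)"
  shows "((\<lambda>x. a * cis (b * fst x) * of_real (g (snd x))) has_derivative
      (\<lambda>v. a * cis (b * s) * Complex (g' * snd v) (b * g t * fst v))) (at (s, t))"
proof -
  have "((\<lambda>x::real \<times> real. g (snd x)) has_derivative (\<lambda>v. snd v * g')) (at (s, t))"
    using assms by (intro DERIV_compose_FDERIV has_derivative_snd has_derivative_ident) auto
  then have "((\<lambda>x. a * cis (b * fst x) * of_real (g (snd x))) has_derivative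
      (\<lambda>v. a * cis (b * s) * of_real (snd v * g')
        + a * ((b * fst v) *\<^sub>R (\<i> * cis (b * s))) * of_real (g t))) (at (s, t))"
    by (auto intro!: derivative_eq_intros)
  then show ?thesis
    by (rule has_derivative_eq_rhs)
      (simp add: fun_eq_iff Complex_eq scaleR_conv_of_real algebra_simps)
qed

section \<open>The parameters of the torus\<close>

locale torus_params =
  fixes m n :: nat
  assumes m_pos: "0 < m" and m_less_n: "m < n" and coprime_m_n: "coprime m n"
begin

abbreviation "k \<equiv> torus_k m n"
abbreviation "r \<equiv> torus_r m n"

text \<open>The squares of all constants of the torus are rational functions of this ratio, which
  reduces the metric to algebra in \<alpha> and the square of sn.\<close>

definition \<alpha> :: real where "\<alpha> = real m / real n"

definition y :: "real \<Rightarrow> real" where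
  "y t = (1 + \<alpha>) * (1 - (1 - \<alpha>) * (jacobi_sn k (r * t))\<^sup>2)"

lemma n_pos: "0 < n"
  using m_less_n by simp

lemma real_m: "real m = \<alpha> * real n"
  using n_pos by (simp add: \<alpha>_def)

lemma \<alpha>_bounds: "0 < \<alpha>" "\<alpha> < 1"
  using m_pos m_less_n by (auto simp: \<alpha>_def)

lemma r_squared: "r\<^sup>2 = 1 + 2 * \<alpha>"
  using n_pos \<alpha>_bounds by (simp add: torus_r_def real_m field_simps)

lemma r_pos: "0 < r"
  using n_pos by (simp add: torus_r_def)

lemma c1_squared: "(torus_c1 m n)\<^sup>2 = (1 + \<alpha>) / (2 + \<alpha>)"
proof -
  have "(torus_c1 m n)\<^sup>2 = (real n + real m) / (2 * real n + real m)"
    by (simp add: torus_c1_def)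
  also have "\<dots> = (real n * (1 + \<alpha>)) / (real n * (2 + \<alpha>))"
    by (simp only: real_m) (simp add: algebra_simps)
  finally show ?thesis using n_pos by simp
qed

lemma c2_squared: "(torus_c2 m n)\<^sup>2 = (1 + \<alpha>) / (1 + 2 * \<alpha>)"
proof -
  have "(torus_c2 m n)\<^sup>2 = (real n + real m) / (real n + 2 * real m)"
    by (simp add: torus_c2_def)
  also have "\<dots> = (real n * (1 + \<alpha>)) / (real n * (1 + 2 * \<alpha>))"
    by (simp only: real_m) (simp add: algebra_simps)
  finally show ?thesis using n_pos by simp
qed

lemma c3_squared: "(torus_c3 m n)\<^sup>2 = 1 / (2 + \<alpha>)"
proof -
  have "(torus_c3 m n)\<^sup>2 = (real n) / (2 * real n + real m)"
    by (simp add: torus_c3_def)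
  also have "\<dots> = (real n * 1) / (real n * (2 + \<alpha>))"
    by (simp only: real_m) (simp add: algebra_simps)
  finally show ?thesis using n_pos by simp
qed

lemma c_pos: "0 < torus_c1 m n" "0 < torus_c2 m n"
  using n_pos by (auto simp: torus_c1_def torus_c2_def)

lemma k_squared: "k\<^sup>2 = (1 - \<alpha>\<^sup>2) / (1 + 2 * \<alpha>)"
proof -
  have "(real m)\<^sup>2 \<le> (real n)\<^sup>2" using m_less_n by simp
  then have "k\<^sup>2 = ((real n)\<^sup>2 - (real m)\<^sup>2) / (real n * (real n + 2 * real m))"
    by (simp add: torus_k_def)
  also have "\<dots> = ((real n)\<^sup>2 * (1 - \<alpha>\<^sup>2)) / ((real n)\<^sup>2 * (1 + 2 * \<alpha>))"
    by (simp only: real_m) (simp add: algebra_simps power2_eq_square)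
  finally show ?thesis using n_pos by simp
qed

lemma k_squared_less: "k\<^sup>2 < 1"
proof -
  have "0 < \<alpha>\<^sup>2" using \<alpha>_bounds by simp
  then show ?thesis using \<alpha>_bounds by (simp add: k_squared field_simps add_pos_pos)
qed

lemma sn_squared_le: "(jacobi_sn k t)\<^sup>2 \<le> 1"
  using jacobi_sn_cn[of k t] by (smt (verit) zero_le_power2)

lemma y_pos: "0 < y t"
proof -
  \<comment> \<open>This leaves at least \<alpha> for the second factor of \<open>y\<close>.\<close>
  have "(1 - \<alpha>) * (jacobi_sn k (r * t))\<^sup>2 \<le> (1 - \<alpha>) * 1"
    using \<alpha>_bounds sn_squared_le by (intro mult_left_mono) auto
  then show ?thesis
    unfolding y_def using \<alpha>_bounds by (intro mult_pos_pos) (linarith, argo)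
qed

section \<open>The induced metric and the conformal factor\<close>

lemma norm_ds_eq_y:
  assumes "S + C = 1"
  shows "(1 + \<alpha>) / (2 + \<alpha>) * C + (1 + \<alpha>) / (1 + 2 * \<alpha>) * (\<alpha>\<^sup>2 * S)
      + 1 / (2 + \<alpha>) * ((1 + \<alpha>)\<^sup>2 * (1 - k\<^sup>2 * S)) = (1 + \<alpha>) * (1 - (1 - \<alpha>) * S)"
proof -
  have C: "C = 1 - S" using assms by simp
  show ?thesis using \<alpha>_bounds
    by (simp add: k_squared C divide_simps) (simp add: algebra_simps power2_eq_square)
qed

text \<open>\<open>S\<close> and \<open>C\<close> stand for the squares of sn and cn, and
  \<open>1 - k\<^sup>2 * S\<close> for that of dn. The terms quadratic in \<open>S\<close> cancel
  because of the value of \<open>k\<^sup>2\<close>. Agreement with the right-hand side of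
  \<open>norm_ds_eq_y\<close> is what makes the map conformal.\<close>

lemma norm_dt_eq_y:
  assumes "S + C = 1"
  shows "(1 + 2 * \<alpha>) * ((1 + \<alpha>) / (2 + \<alpha>) * (S * (1 - k\<^sup>2 * S))
      + (1 + \<alpha>) / (1 + 2 * \<alpha>) * (C * (1 - k\<^sup>2 * S))
      + 1 / (2 + \<alpha>) * ((k\<^sup>2)\<^sup>2 * (S * C))) = (1 + \<alpha>) * (1 - (1 - \<alpha>) * S)"
proof -
  have C: "C = 1 - S" using assms by simp
  show ?thesis using \<alpha>_bounds
    by (simp add: k_squared C divide_simps) (simp add: algebra_simps power2_eq_square)
qed


lemma has_real_derivative_scale: "((*) r has_real_derivative r) (at t)"
  by (auto intro!: derivative_eq_intros)

lemma has_derivative_torus_map: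
  fixes s t :: real
  defines "S \<equiv> jacobi_sn k (r * t)" and "C \<equiv> jacobi_cn k (r * t)" and "D \<equiv> jacobi_dn k (r * t)"
  shows "(torus_map m n has_derivative (\<lambda>v.
      (of_real (torus_c1 m n) * cis (1 * s) * Complex (- S * D * r * snd v) (1 * C * fst v),
       \<i> * of_real (torus_c2 m n) * cis (\<alpha> * s) * Complex (C * D * r * snd v) (\<alpha> * S * fst v),
       of_real (torus_c3 m n) * cis (- (1 + \<alpha>) * s)
         * Complex (- k\<^sup>2 * S * C * r * snd v) (- (1 + \<alpha>) * D * fst v)))) (at (s, t))"
proof -
  note k = k_squared_less
  \<comment> \<open>Projections and an explicit frequency 1 make each coordinate match the pattern
    of \<open>has_derivative_cis_mult\<close>.\<close>
  have "torus_map m n = (\<lambda>x.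
      (of_real (torus_c1 m n) * cis (1 * fst x) * of_real (jacobi_cn k (r * snd x)),
       \<i> * of_real (torus_c2 m n) * cis (\<alpha> * fst x) * of_real (jacobi_sn k (r * snd x)),
       of_real (torus_c3 m n) * cis (- (1 + \<alpha>) * fst x) * of_real (jacobi_dn k (r * snd x))))"
    by (simp add: torus_map_def \<alpha>_def case_prod_unfold)
  then show ?thesis
    unfolding S_def C_def D_def
    by (auto simp only: intro!: has_derivative_Pair has_derivative_cis_mult[where t = t]
      DERIV_chain2[OF has_real_derivative_jacobi_sn[OF k] has_real_derivative_scale]
      DERIV_chain2[OF has_real_derivative_jacobi_cn[OF k] has_real_derivative_scale]
      DERIV_chain2[OF has_real_derivative_jacobi_dn[OF k] has_real_derivative_scale])
qed

lemma induced_metric_torus_map: "induced_metric (torus_map m n) (s, t) v w = y t * (v \<bullet> w)"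
proof -
  define S C D where "S = jacobi_sn k (r * t)" and "C = jacobi_cn k (r * t)"
    and "D = jacobi_dn k (r * t)"
  have sum: "S\<^sup>2 + C\<^sup>2 = 1" and D: "D\<^sup>2 = 1 - k\<^sup>2 * S\<^sup>2"
    unfolding S_def C_def D_def by (rule jacobi_sn_cn, rule jacobi_dn_squared[OF k_squared_less])
  have "induced_metric (torus_map m n) (s, t) v w =
      (torus_c1 m n)\<^sup>2 * ((S * D * r)\<^sup>2 * (snd v * snd w) + C\<^sup>2 * (fst v * fst w))
    + (torus_c2 m n)\<^sup>2 * ((C * D * r)\<^sup>2 * (snd v * snd w) + (\<alpha> * S)\<^sup>2 * (fst v * fst w))
    + (torus_c3 m n)\<^sup>2 * ((k\<^sup>2 * S * C * r)\<^sup>2 * (snd v * snd w) + ((1 + \<alpha>) * D)\<^sup>2 * (fst v * fst w))"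
    unfolding induced_metric_def frechet_derivative_at[OF has_derivative_torus_map, symmetric]
      S_def[symmetric] C_def[symmetric] D_def[symmetric] inner_prod_def prod.sel inner_mult_complex
    by (simp add: norm_mult inner_complex_def)
      (simp add: power2_eq_square algebra_simps)
  \<comment> \<open>Sorting by direction produces exactly the brackets evaluated by
    \<open>norm_ds_eq_y\<close> and \<open>norm_dt_eq_y\<close>.\<close>
  also have "\<dots> =
      ((torus_c1 m n)\<^sup>2 * C\<^sup>2 + (torus_c2 m n)\<^sup>2 * (\<alpha>\<^sup>2 * S\<^sup>2)
        + (torus_c3 m n)\<^sup>2 * ((1 + \<alpha>)\<^sup>2 * D\<^sup>2)) * (fst v * fst w)
    + r\<^sup>2 * ((torus_c1 m n)\<^sup>2 * (S\<^sup>2 * D\<^sup>2) + (torus_c2 m n)\<^sup>2 * (C\<^sup>2 * D\<^sup>2)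
        + (torus_c3 m n)\<^sup>2 * ((k\<^sup>2)\<^sup>2 * (S\<^sup>2 * C\<^sup>2))) * (snd v * snd w)"
    by (simp add: power_mult_distrib) (simp add: algebra_simps)
  also have "\<dots> = y t * (v \<bullet> w)"
    unfolding c1_squared c2_squared c3_squared r_squared D norm_ds_eq_y[OF sum] norm_dt_eq_y[OF sum]
    by (simp add: y_def S_def inner_prod_def algebra_simps)
  finally show ?thesis .
qed

lemma conformal_factor_torus_map: "conformal_factor (torus_map m n) = y"
  unfolding conformal_factor_def induced_metric_torus_map
proof (rule the_equality)
  fix y' :: "real \<Rightarrow> real"
  assume *: "\<forall>(s::real) t (v::real \<times> real) w. y t * (v \<bullet> w) = y' t * (v \<bullet> w)"
  \<comment> \<open>Testing the metric on one unit vector determines the factor.\<close>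
  have "y t * ((1 :: real, 0 :: real) \<bullet> (1, 0)) = y' t * ((1 :: real, 0 :: real) \<bullet> (1, 0))" for t
    using * by (elim allE)
  then show "y' = y" by (simp add: fun_eq_iff)
qed simp

lemma area_density_torus_map: "area_density (torus_map m n) x = y (snd x)"
proof -
  obtain s t where "x = (s, t)" by (cases x)
  then show ?thesis
    using y_pos[of t] by (simp add: area_density_def induced_metric_torus_map)
qed

section \<open>The period lattice\<close>

lemma mem_period_lattice_iff:
  "(a, b) \<in> period_lattice (torus_map m n) \<longleftrightarrow>
    (\<exists>l j :: int. a = of_int (int n * l) * pi \<and> b = of_int j * (2 * elliptic_K k / r)
      \<and> (even (int n * l) \<longleftrightarrow> even j) \<and> (even (int m * l) \<longleftrightarrow> even j))"
  (is "_ \<longleftrightarrow> ?P")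
proof
  assume "(a, b) \<in> period_lattice (torus_map m n)"
  then have per: "torus_map m n (s + a, t + b) = torus_map m n (s, t)" for s t
    by (simp add: period_lattice_def)
  \<comment> \<open>The second coordinate vanishes at the origin, hence at every period.\<close>
  have "jacobi_sn k (r * b) = 0"
    using per[of 0 0] c_pos
    by (simp add: torus_map_def jacobi_sn_def jacobi_am_0 k_squared_less)
  then obtain j :: int where rb: "r * b = 2 * of_int j * elliptic_K k"
    using jacobi_sn_eq_0_iff k_squared_less by blast
  then have b: "b = of_int j * (2 * elliptic_K k / r)"
    using r_pos by (simp add: field_simps)
  \<comment> \<open>The first coordinate at the origin: the phase must undo the sign acquired by
    cn.\<close>
  have "cis a * of_real (jacobi_cn k (2 * of_int j * elliptic_K k)) = 1"
    using per[of 0 0] c_pos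
    by (simp add: torus_map_def rb jacobi_cn_def jacobi_am_0 k_squared_less)
  then have "cis a = (if even j then 1 else - 1)"
    using jacobi_cn_plus_int_K[OF k_squared_less, of 0 j]
    by (simp add: jacobi_cn_def jacobi_am_0 k_squared_less minus_equation_iff[of "cis a"] split: if_splits)
  then obtain i1 :: int where i1: "a = of_int i1 * pi" "even i1 \<longleftrightarrow> even j"
    unfolding cis_eq_sign_iff by blast
  \<comment> \<open>The second coordinate vanishes at the origin and says nothing there about its
    phase; at this quarter period sn is 1.\<close>
  define t where "t = elliptic_K k / r"
  have sn: "jacobi_sn k (elliptic_K k) = 1"
    by (simp add: jacobi_sn_def elliptic_K_def jacobi_am_elliptic_F k_squared_less)
  have rt: "r * t = elliptic_K k" "r * (t + b) = elliptic_K k + 2 * of_int j * elliptic_K k"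
    using r_pos by (simp_all add: t_def distrib_left rb)
  have "cis (\<alpha> * a) * of_real (if even j then 1 else - 1) = 1"
    using per[of 0 t] c_pos
    by (simp add: torus_map_def rt jacobi_sn_plus_int_K[OF k_squared_less] sn \<alpha>_def)
  then have "cis (\<alpha> * a) = (if even j then 1 else - 1)"
    by (simp add: minus_equation_iff[of "cis (\<alpha> * a)"] split: if_splits)
  then obtain i2 :: int where i2: "\<alpha> * a = of_int i2 * pi" "even i2 \<longleftrightarrow> even j"
    unfolding cis_eq_sign_iff by blast
  \<comment> \<open>Comparing the two expressions for \<open>a\<close>; coprimality then makes
    \<open>i1\<close> a multiple of \<open>n\<close>.\<close>
  have "real m * of_int i1 = real n * of_int i2"
    using i1(1) i2(1) n_pos by (simp add: \<alpha>_def field_simps)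
  then have mi: "int m * i1 = int n * i2"
    by (metis of_int_eq_iff of_int_mult of_int_of_nat_eq)
  then have "int n dvd i1"
    using coprime_m_n by (metis coprime_commute coprime_dvd_mult_right_iff coprime_int_iff dvd_triv_left)
  then obtain l where l: "i1 = int n * l" by blast
  with mi have "i2 = int m * l" using n_pos by simp
  with l i1 i2 b show ?P by blast
next
  assume ?P
  then obtain l j :: int where a: "a = of_int (int n * l) * pi"
    and b: "b = of_int j * (2 * elliptic_K k / r)"
    and n: "even (int n * l) \<longleftrightarrow> even j" and m: "even (int m * l) \<longleftrightarrow> even j" by blast
  have a1: "cis a = (if even j then 1 else - 1)"
    unfolding cis_eq_sign_iff using a n by blast
  have "\<alpha> * a = of_int (int m * l) * pi"
    using n_pos by (simp add: \<alpha>_def a)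
  then have a2: "cis (\<alpha> * a) = (if even j then 1 else - 1)"
    unfolding cis_eq_sign_iff using m by blast
  \<comment> \<open>The third phase is conjugate to the product of the first two, whose equal signs
    multiply to 1, in accordance with the invariance of dn.\<close>
  have "cis (- (1 + \<alpha>) * a) = cnj (cis a * cis (\<alpha> * a))"
    by (simp add: cis_mult cis_cnj algebra_simps)
  then have a3: "cis (- (1 + \<alpha>) * a) = 1" by (simp add: a1 a2)
  have b': "r * (t + b) = r * t + 2 * of_int j * elliptic_K k" for t
    using r_pos by (simp add: b field_simps)
  have "torus_map m n (s + a, t + b) = torus_map m n (s, t)" for s t
    unfolding torus_map_def prod.case b' jacobi_sn_plus_int_K[OF k_squared_less]
      jacobi_cn_plus_int_K[OF k_squared_less] jacobi_dn_plus_int_K[OF k_squared_less]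
    unfolding \<alpha>_def[symmetric] distrib_left cis_mult[symmetric] a1 a2 a3
    by simp
  then show "(a, b) \<in> period_lattice (torus_map m n)"
    by (auto simp: period_lattice_def)
qed


section \<open>The area as a multiple of \<open>torus_A\<close>\<close>

lemma y_plus_int_K: "y (t + of_int j * (2 * elliptic_K k / r)) = y t"
proof -
  have "r * (t + of_int j * (2 * elliptic_K k / r)) = r * t + 2 * of_int j * elliptic_K k"
    using r_pos by (simp add: field_simps)
  then show ?thesis
    by (simp add: y_def jacobi_sn_plus_int_K[OF k_squared_less] power_mult_distrib)
qed

lemma continuous_on_y: "continuous_on UNIV y"
proof -
  have "isCont (jacobi_sn k) t" for t
    using has_real_derivative_jacobi_sn[OF k_squared_less] DERIV_isCont by blast
  then have sn: "continuous_on UNIV (jacobi_sn k)"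
    by (simp add: continuous_at_imp_continuous_on)
  show ?thesis
    unfolding y_def[abs_def] by (intro continuous_intros continuous_on_compose2[OF sn]) auto
qed

text \<open>Gives countability of the lattice and shows that periods move the second coordinate by
  multiples of \<open>2 * elliptic_K k / r\<close>, under which \<open>y\<close> is
  invariant.\<close>

lemma period_lattice_subset:
  "period_lattice (torus_map m n) \<subseteq> range (\<lambda>(l :: int, j :: int).
    (of_int (int n * l) * pi, of_int j * (2 * elliptic_K k / r)))"
proof
  fix p assume p: "p \<in> period_lattice (torus_map m n)"
  obtain a b where ab: "p = (a, b)" by (cases p)
  from p obtain l j :: int where "a = of_int (int n * l) * pi" "b = of_int j * (2 * elliptic_K k / r)"
    unfolding ab mem_period_lattice_iff by blast
  then show "p \<in> range (\<lambda>(l :: int, j :: int).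
      (of_int (int n * l) * pi, of_int j * (2 * elliptic_K k / r)))"
    unfolding ab by (intro range_eqI[of _ _ "(l, j)"]) simp
qed

lemma torus_area_eq_rectangle:
  fixes w h :: real
  assumes "fundamental_domain (period_lattice (torus_map m n)) ({0..<w} \<times> {0..<h})"
    and "0 < w" "0 < h"
  shows "torus_area m n = w * (LBINT t=ereal 0..ereal h. y t)"
proof -
  have density: "area_density (torus_map m n) = (\<lambda>x. y (snd x))"
    by (simp add: fun_eq_iff area_density_torus_map)
  have "countable (period_lattice (torus_map m n))"
    by (rule countable_subset[OF period_lattice_subset]) simp
  moreover have "area_density (torus_map m n) \<in> borel_measurable borel"
    unfolding density
    by (intro borel_measurable_continuous_onI continuous_on_compose2[OF continuous_on_y] continuous_intros) auto
  moreover have "area_density (torus_map m n) (x + p) = area_density (torus_map m n) x"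
    if "p \<in> period_lattice (torus_map m n)" for p x
    using that period_lattice_subset y_plus_int_K by (auto simp: density)
  ultimately have "torus_area m n = (LINT x:{0..<w} \<times> {0..<h}|lborel. y (snd x))"
    unfolding torus_area_def
    using quotient_area_eq[OF _ _ _ _ assms(1)] y_pos by (simp add: density less_imp_le)
  also have "\<dots> = w * (LBINT t=ereal 0..ereal h. y t)"
    using assms y_pos by (intro set_lebesgue_integral_strip continuous_on_y) (auto simp: less_imp_le)
  finally show ?thesis .
qed

text \<open>With this antiderivative, statements about integrals of \<open>y\<close> become
  statements about functions with known derivative.\<close>

definition Y :: "real \<Rightarrow> real" where
  "Y t = (LBINT s=ereal 0..ereal t. y s)"

lemma has_real_derivative_Y: "(Y has_real_derivative y t) (at t)"
  unfolding Y_def[abs_def] by (rule has_real_derivative_interval_integral[OF continuous_on_y])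

lemma Y_0: "Y 0 = 0"
  by (simp add: Y_def interval_integral_endpoints_same)

lemma torus_A_eq: "torus_A m n = Y (2 * elliptic_K k / r)"
  by (simp add: torus_A_def conformal_factor_torus_map Y_def)

text \<open>By periodicity of \<open>y\<close> the increment of \<open>Y\<close> over one period is
  constant, so two periods contribute equally.\<close>

lemma Y_double_period: "Y (4 * elliptic_K k / r) = 2 * torus_A m n"
proof -
  define T where "T = 2 * elliptic_K k / r"
  have "((\<lambda>t. Y (t + T) - Y t) has_real_derivative 0) (at t)" for t
    using y_plus_int_K[of t 1]
    by (auto intro!: derivative_eq_intros has_real_derivative_Y DERIV_chain2[OF has_real_derivative_Y]
      simp: T_def)
  then have "Y (T + T) - Y T = Y (0 + T) - Y 0"
    by (intro DERIV_isconst_all) auto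
  moreover have "T + T = 4 * elliptic_K k / r" by (simp add: T_def)
  ultimately show ?thesis by (simp add: Y_0 torus_A_eq T_def)
qed

lemma torus_area_odd:
  assumes "odd (m * n)"
  shows "torus_area m n = 2 * real n * pi * torus_A m n"
proof -
  define T where "T = 2 * elliptic_K k / r"
  have T: "0 < T" using r_pos elliptic_K_pos[OF k_squared_less] by (simp add: T_def)
  have w: "0 < 2 * real n * pi" using n_pos by simp
  have "p \<in> period_lattice (torus_map m n) \<longleftrightarrow>
      p \<in> {(of_int j * (real n * pi) + of_int i * (2 * real n * pi), of_int j * T) |i j :: int. True}" for p
  proof -
    obtain a b where ab: "p = (a, b)" by (cases p)
    have "p \<in> period_lattice (torus_map m n) \<longleftrightarrow>
        (\<exists>l j :: int. a = of_int (int n * l) * pi \<and> b = of_int j * T \<and> (even l \<longleftrightarrow> even j))"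
      using assms unfolding ab mem_period_lattice_iff T_def by auto
    also have "\<dots> \<longleftrightarrow> (\<exists>i j :: int. a = of_int (int n * (j + 2 * i)) * pi \<and> b = of_int j * T)"
    proof -
      \<comment> \<open>With \<open>m\<close> and \<open>n\<close> odd, both parity conditions say
        that \<open>l\<close> and \<open>j\<close> are congruent. Substituting
        \<open>l = j + 2 * i\<close> exhibits the basis \<open>(2 * n * pi, 0)\<close>,
        \<open>(n * pi, T)\<close>.\<close>
      have *: "(even l \<longleftrightarrow> even j) \<longleftrightarrow> (\<exists>i. l = j + 2 * i)" for l j :: int by presburger
      show ?thesis unfolding * by blast
    qed
    finally show ?thesis unfolding ab by (simp add: algebra_simps)
  qed
  then have "period_lattice (torus_map m n) =
      {(of_int j * (real n * pi) + of_int i * (2 * real n * pi), of_int j * T) |i j :: int. True}"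
    by (intro set_eqI)
  with fundamental_domain_rectangle[OF w T, of "real n * pi"]
  have "fundamental_domain (period_lattice (torus_map m n)) ({0..<2 * real n * pi} \<times> {0..<T})"
    by (simp only:)
  from torus_area_eq_rectangle[OF this w T] show ?thesis
    by (simp add: torus_A_eq Y_def T_def)
qed

lemma torus_area_even:
  assumes "even (m * n)"
  shows "torus_area m n = 4 * real n * pi * torus_A m n"
proof -
  \<comment> \<open>Twice the period of \<open>y\<close>, since only even \<open>j\<close> occur for
    even \<open>m * n\<close>.\<close>
  define T where "T = 4 * elliptic_K k / r"
  have T: "0 < T" using r_pos elliptic_K_pos[OF k_squared_less] by (simp add: T_def)
  have w: "0 < 2 * real n * pi" using n_pos by simp
  \<comment> \<open>Exactly one of \<open>m\<close> and \<open>n\<close> is even: that one forces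
    \<open>j\<close> to be even, and the odd one then forces \<open>l\<close> to be even.\<close>
  have "\<not> (even m \<and> even n)" using coprime_m_n coprime_common_divisor[of m n 2] by auto
  then have parity: "(even (int n * l) \<longleftrightarrow> even j) \<and> (even (int m * l) \<longleftrightarrow> even j) \<longleftrightarrow> even l \<and> even j"
    for l j :: int using assms by auto
  have "p \<in> period_lattice (torus_map m n) \<longleftrightarrow>
      p \<in> {(of_int j * 0 + of_int i * (2 * real n * pi), of_int j * T) |i j :: int. True}" for p
  proof -
    obtain a b where ab: "p = (a, b)" by (cases p)
    have "p \<in> period_lattice (torus_map m n) \<longleftrightarrow>
        (\<exists>l j :: int. a = of_int (int n * l) * pi \<and> b = of_int j * (2 * elliptic_K k / r)
          \<and> even l \<and> even j)"
      unfolding ab mem_period_lattice_iff parity ..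
    also have "\<dots> \<longleftrightarrow> (\<exists>i j :: int. a = of_int i * (2 * real n * pi) \<and> b = of_int j * T)"
    proof safe
      fix l j :: int
      assume "even l" "even j"
      then obtain i j' where "l = 2 * i" "j = 2 * j'" by (elim evenE)
      then show "\<exists>i j'. of_int (int n * l) * pi = of_int i * (2 * real n * pi)
          \<and> of_int j * (2 * elliptic_K k / r) = of_int j' * T"
        by (intro exI[of _ i] exI[of _ j']) (simp add: T_def)
    next
      fix i j :: int
      show "\<exists>l j'. of_int i * (2 * real n * pi) = of_int (int n * l) * pi
          \<and> of_int j * T = of_int j' * (2 * elliptic_K k / r) \<and> even l \<and> even j'"
        by (intro exI[of _ "2 * i"] exI[of _ "2 * j"]) (simp add: T_def)
    qed
    finally show ?thesis unfolding ab by simp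
  qed
  then have "period_lattice (torus_map m n) =
      {(of_int j * 0 + of_int i * (2 * real n * pi), of_int j * T) |i j :: int. True}"
    by (intro set_eqI)
  with fundamental_domain_rectangle[OF w T, of 0]
  have "fundamental_domain (period_lattice (torus_map m n)) ({0..<2 * real n * pi} \<times> {0..<T})"
    by (simp only:)
  from torus_area_eq_rectangle[OF this w T] show ?thesis
    using Y_double_period by (simp add: Y_def T_def)
qed

section \<open>Bounds for \<open>torus_A\<close>\<close>

lemma Y_increment_greater:
  assumes "a < b" and g: "\<And>t. (g has_real_derivative g' t) (at t)" and less: "\<And>t. g' t < y t"
  shows "g b - g a < Y b - Y a"
proof -
  have "Y a - g a < Y b - g b"
  proof (rule DERIV_pos_imp_increasing[OF assms(1)])
    fix t :: real
    have "((\<lambda>t. Y t - g t) has_real_derivative y t - g' t) (at t)"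
      by (intro derivative_intros has_real_derivative_Y g)
    with less[of t] show "\<exists>d. ((\<lambda>t. Y t - g t) has_real_derivative d) (at t) \<and> 0 < d"
      by (intro exI[of _ "y t - g' t"]) simp
  qed
  then show ?thesis by simp
qed

lemma Y_increment_less:
  assumes "a < b" and g: "\<And>t. (g has_real_derivative g' t) (at t)" and less: "\<And>t. y t < g' t"
  shows "Y b - Y a < g b - g a"
proof -
  have "g a - Y a < g b - Y b"
  proof (rule DERIV_pos_imp_increasing[OF assms(1)])
    fix t :: real
    have "((\<lambda>t. g t - Y t) has_real_derivative g' t - y t) (at t)"
      by (intro derivative_intros has_real_derivative_Y g)
    with less[of t] show "\<exists>d. ((\<lambda>t. g t - Y t) has_real_derivative d) (at t) \<and> 0 < d"
      by (intro exI[of _ "g' t - y t"]) simp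
  qed
  then show ?thesis by simp
qed

text \<open>The factor \<open>r\<^sup>2\<close> clears the denominator of \<open>k\<^sup>2\<close>,
  so that both comparisons with \<open>y\<close> become polynomial after squaring.\<close>

lemma r_dn_squared:
  "(r * jacobi_dn k t)\<^sup>2 = 1 + 2 * \<alpha> - (1 - \<alpha>\<^sup>2) * (jacobi_sn k t)\<^sup>2"
  unfolding power_mult_distrib r_squared jacobi_dn_squared[OF k_squared_less] k_squared
  using \<alpha>_bounds by (simp add: field_simps)

text \<open>Homogenising with \<open>C + S = 1\<close> displays the difference of squares as
  \<open>\<alpha>\<^sup>2\<close> times a quadratic form in \<open>C\<close> and \<open>S\<close>
  with positive coefficients.\<close>

lemma abs_cn_dn_less_y: "\<bar>jacobi_cn k (r * t) * (r * jacobi_dn k (r * t))\<bar> < y t"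
proof -
  define S C where "S = (jacobi_sn k (r * t))\<^sup>2" and "C = (jacobi_cn k (r * t))\<^sup>2"
  have SC: "0 \<le> S" "0 \<le> C" and C: "C = 1 - S"
    using jacobi_sn_cn[of k "r * t"] by (auto simp: S_def C_def)
  have "(y t)\<^sup>2 - (jacobi_cn k (r * t) * (r * jacobi_dn k (r * t)))\<^sup>2 =
      ((1 + \<alpha>) * (1 - (1 - \<alpha>) * S))\<^sup>2 - C * (1 + 2 * \<alpha> - (1 - \<alpha>\<^sup>2) * S)"
    by (simp add: y_def power_mult_distrib[of "jacobi_cn k (r * t)"] r_dn_squared S_def C_def)
  also have "\<dots> = \<alpha>\<^sup>2 * (C\<^sup>2 + (3 + 2 * \<alpha>) * (C * S) + (1 + \<alpha>)\<^sup>2 * S\<^sup>2)"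
    by (simp add: C) (simp add: algebra_simps power2_eq_square)
  also have "\<dots> > 0"
  proof (rule mult_pos_pos)
    show "0 < \<alpha>\<^sup>2" using \<alpha>_bounds by simp
    have "0 < C\<^sup>2 + (1 + \<alpha>)\<^sup>2 * S\<^sup>2"
    \<comment> \<open>\<open>C\<close> and \<open>S\<close> are not both zero, as they sum to
      1.\<close>
    proof (cases "S = 0")
      case True
      then show ?thesis using C by simp
    next
      case False
      then show ?thesis using \<alpha>_bounds by (intro add_nonneg_pos) auto
    qed
    moreover have "0 \<le> (3 + 2 * \<alpha>) * (C * S)" using SC \<alpha>_bounds by simp
    ultimately show "0 < C\<^sup>2 + (3 + 2 * \<alpha>) * (C * S) + (1 + \<alpha>)\<^sup>2 * S\<^sup>2" by linarith
  qed
  finally have "\<bar>jacobi_cn k (r * t) * (r * jacobi_dn k (r * t))\<bar>\<^sup>2 < (y t)\<^sup>2" by simp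
  then show ?thesis by (rule power2_less_imp_less) (simp add: y_pos less_imp_le)
qed

text \<open>The difference of squares is a concave function of \<open>C\<close>, positive at \<open>C = 0\<close> and \<open>C = 1\<close>.\<close>

lemma y_less_dn: "y t < 2 / sqrt 3 * (r * jacobi_dn k (r * t))"
proof -
  define S C where "S = (jacobi_sn k (r * t))\<^sup>2" and "C = (jacobi_cn k (r * t))\<^sup>2"
  have SC: "0 \<le> S" "0 \<le> C" and S: "S = 1 - C"
    using jacobi_sn_cn[of k "r * t"] by (auto simp: S_def C_def)
  have "3 * ((2 / sqrt 3 * (r * jacobi_dn k (r * t)))\<^sup>2 - (y t)\<^sup>2) =
      4 * (1 + 2 * \<alpha> - (1 - \<alpha>\<^sup>2) * S) - 3 * ((1 + \<alpha>) * (1 - (1 - \<alpha>) * S))\<^sup>2"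
    by (simp add: y_def power_mult_distrib[of "2 / sqrt 3"] r_dn_squared S_def power_divide right_diff_distrib)
  \<comment> \<open>The coefficients of \<open>S\<close> and \<open>C\<close> are the values at
    \<open>C = 0\<close> and at \<open>C = 1\<close>; the product \<open>C * S\<close> carries the
    concave part.\<close>
  also have "\<dots> = S * (\<alpha> * ((1 - \<alpha>) * (8 + 9 * \<alpha> + 3 * \<alpha>\<^sup>2))) + C * ((1 - \<alpha>) * (1 + 3 * \<alpha>))
      + 3 * (1 + \<alpha>)\<^sup>2 * (1 - \<alpha>)\<^sup>2 * (C * S)"
    by (simp add: S) (simp add: algebra_simps power2_eq_square)
  also have "\<dots> > 0"
  proof -
    have A: "0 < \<alpha> * ((1 - \<alpha>) * (8 + 9 * \<alpha> + 3 * \<alpha>\<^sup>2))" and B: "0 < (1 - \<alpha>) * (1 + 3 * \<alpha>)"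
      using \<alpha>_bounds by (auto intro!: mult_pos_pos add_pos_nonneg)
    have "0 < S * (\<alpha> * ((1 - \<alpha>) * (8 + 9 * \<alpha> + 3 * \<alpha>\<^sup>2))) + C * ((1 - \<alpha>) * (1 + 3 * \<alpha>))"
    proof (cases "C = 0")
      case True
      then show ?thesis using S A by simp
    next
      case False
      then show ?thesis using SC A B \<alpha>_bounds by (intro add_nonneg_pos mult_pos_pos) auto
    qed
    moreover have "0 \<le> 3 * (1 + \<alpha>)\<^sup>2 * (1 - \<alpha>)\<^sup>2 * (C * S)" using SC by simp
    ultimately show ?thesis by linarith
  qed
  finally have "(y t)\<^sup>2 < (2 / sqrt 3 * (r * jacobi_dn k (r * t)))\<^sup>2" by simp
  then show ?thesis
    by (rule power2_less_imp_less)
      (use r_pos jacobi_dn_pos[OF k_squared_less, of "r * t"] in \<open>simp add: less_imp_le\<close>)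
qed

lemma jacobi_am_K: "jacobi_am k (elliptic_K k) = pi / 2" "jacobi_am k (2 * elliptic_K k) = pi"
proof -
  show "jacobi_am k (elliptic_K k) = pi / 2"
    unfolding elliptic_K_def by (rule jacobi_am_elliptic_F[OF k_squared_less])
  show "jacobi_am k (2 * elliptic_K k) = pi"
    using jacobi_am_plus_int_K[OF k_squared_less, of 0 1] by (simp add: jacobi_am_0 k_squared_less)
qed

text \<open>Each half of the period contributes more than 1, compared with sn while it rises and
  with its negative while it falls. Formally at \<alpha> = 0 one has \<open>k = r = 1\<close>, and
  both sides of the comparison equal the square of cn.\<close>

lemma torus_A_greater: "2 < torus_A m n"
proof -
  define T where "T = elliptic_K k / r"
  have T: "0 < T" "r * T = elliptic_K k" "r * (2 * T) = 2 * elliptic_K k"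
    using r_pos elliptic_K_pos[OF k_squared_less] by (simp_all add: T_def)
  let ?g = "\<lambda>t. jacobi_sn k (r * t)" and ?g' = "\<lambda>t. jacobi_cn k (r * t) * (r * jacobi_dn k (r * t))"
  have g: "(?g has_real_derivative ?g' t) (at t)" for t
    using DERIV_chain2[OF has_real_derivative_jacobi_sn[OF k_squared_less] has_real_derivative_scale]
    by (simp add: mult_ac)
  have "?g T - ?g 0 < Y T - Y 0"
    using abs_cn_dn_less_y by (intro Y_increment_greater[OF T(1) g]) (simp add: abs_less_iff)
  moreover have "- ?g (2 * T) - - ?g T < Y (2 * T) - Y T"
  proof (rule Y_increment_greater)
    show "((\<lambda>t. - ?g t) has_real_derivative - ?g' t) (at t)" for t
      by (rule DERIV_minus[OF g])
    show "- ?g' t < y t" for t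
      using abs_cn_dn_less_y[of t] by (simp add: abs_less_iff)
  qed (use T(1) in simp)
  ultimately have "2 < Y (2 * T)"
    unfolding T by (simp add: jacobi_sn_def jacobi_am_K jacobi_am_0 k_squared_less Y_0)
  then show ?thesis by (simp add: torus_A_eq T_def)
qed

text \<open>The amplitude gains \<open>pi\<close> over the period. The constant
  \<open>2 / sqrt 3\<close> is the ratio of \<open>y\<close> to \<open>r * dn\<close> formally at
  \<alpha> = 1, where \<open>k = 0\<close>, \<open>y = 2\<close> and
  \<open>r = sqrt 3\<close>.\<close>

lemma torus_A_less: "torus_A m n < 2 * pi / sqrt 3"
proof -
  define T where "T = 2 * elliptic_K k / r"
  have T: "0 < T" "r * T = 2 * elliptic_K k"
    using r_pos elliptic_K_pos[OF k_squared_less] by (simp_all add: T_def)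
  let ?g = "\<lambda>t. 2 / sqrt 3 * jacobi_am k (r * t)"
  have g: "(?g has_real_derivative 2 / sqrt 3 * (r * jacobi_dn k (r * t))) (at t)" for t
    using DERIV_cmult[OF DERIV_chain2[OF has_real_derivative_jacobi_am[OF k_squared_less]
      has_real_derivative_scale], of "2 / sqrt 3" t]
    by (simp add: mult_ac)
  have "Y T - Y 0 < ?g T - ?g 0"
    by (intro Y_increment_less[OF T(1) g] y_less_dn)
  then show ?thesis
    unfolding T by (simp add: jacobi_am_K jacobi_am_0 k_squared_less Y_0 torus_A_eq T_def)
qed

end

theorem theoremG:
  fixes m n :: nat
  assumes "0 < m" and "m < n" and "coprime m n"
  shows "torus_area m n =
           (if even (m * n) then 4 * real n * pi * torus_A m n
            else 2 * real n * pi * torus_A m n) \<and>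
         (even (m * n) \<longrightarrow>
           2 * real n < 1 / (4 * pi) * torus_area m n \<and>
           1 / (4 * pi) * torus_area m n < 2 * pi / sqrt 3 * real n) \<and>
         (odd (m * n) \<longrightarrow>
           real n < 1 / (4 * pi) * torus_area m n \<and>
           1 / (4 * pi) * torus_area m n < pi / sqrt 3 * real n)"
proof -
  interpret torus_params m n using assms by unfold_locales
  \<comment> \<open>Divided by \<open>4 * pi\<close>, the area is \<open>n * torus_A m n\<close> for
    even \<open>m * n\<close> and half of that for odd \<open>m * n\<close>.\<close>
  have "real n * 2 < real n * torus_A m n" "real n * torus_A m n < real n * (2 * pi / sqrt 3)"
    by (rule mult_strict_left_mono; use n_pos torus_A_greater torus_A_less in simp)+
  then show ?thesis
    using torus_area_even torus_area_odd by (simp add: mult_ac)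
qed

end
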